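(* Let $T\geq 1$ be an integer and $w$ an infinite word. Then $w$ is periodic by projection with the period $T$ and is mixing if and only if for each $1\leq i\leq T$ and for each $n$ the group $G_n(w)$ contains any permutation on the indices $i,i+T,\ldots,i+kT$, where $i+kT\leq n$ (i.e. any permutation of $\{1,\dots,n\}$ that permutes these indices and fixes all other elements).
   Context: An infinite word is a one-sided sequence $w=w_0w_1w_2\cdots$ of letters from a finite alphabet $\Sigma$. $F_n(w)$ denotes the set of factors (contiguous blocks) of length $n$ of $w$. A permutation $g\in S_n$ of $\{1,\dots,n\}$ acts on a word $u=u_1\cdots u_n$ by $g(u)=u_{g^{-1}(1)}\cdots u_{g^{-1}(n)}$. The symmetry group of order $n$ of $w$ is $G_n(w)=\{\pi\in S_n \mid \pi(x)\in F_n(w)\text{ for each }x\in F_n(w)\}$. An infinite word is universal over an alphabet $\Sigma'$ if its set of factors is $\Sigma'^*$. A word $w$ is periodic by projection with period $T$ if for each $i\in\{0,\dots,T-1\}$ the word $w_iw_{i+T}w_{i+2T}\cdots$ is universal over some subalphabet $\Sigma_i\subseteq\Sigma$. A word $w$ that is periodic by projection with period $T$ is mixing if for each $n$ and all choices of subwords $w_{i_j}w_{i_j+T}\cdots w_{i_j+(n-1)T}$ with $i_j\equiv j\pmod T$, $j=1,\dots,T$, the word $w_{i_1}w_{i_2}\cdots w_{i_T}\,w_{i_1+T}w_{i_2+T}\cdots w_{i_T+T}\cdots w_{i_1+(n-1)T}w_{i_2+(n-1)T}\cdots w_{i_T+(n-1)T}$ is a factor of $w$. *)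

theory Defs
  imports "HOL-Library.Omega_Words_Fun" "HOL-Combinatorics.Permutations" "HOL-Number_Theory.Cong"
begin

definition factors :: "'a word \<Rightarrow> 'a list set" where
  "factors w = {w [i \<rightarrow> j] | i j. i \<le> j}"

definition factors_of_length :: "nat \<Rightarrow> 'a word \<Rightarrow> 'a list set" where
  "factors_of_length n w = {u \<in> factors w. length u = n}"

text \<open>
  Permutations act on the positions \<open>1, \<dots>, n\<close> of a word \<open>u\<close> of length \<open>n\<close>, whereas list
  indexing starts at \<open>0\<close>: the letter at position \<open>j\<close> is \<open>u ! (j - 1)\<close>.
\<close>

definition perm_act :: "(nat \<Rightarrow> nat) \<Rightarrow> 'a list \<Rightarrow> 'a list" where
  "perm_act g u = map (\<lambda>j. u ! (inv g j - 1)) [1..<length u + 1]"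

definition symmetry_group :: "nat \<Rightarrow> 'a word \<Rightarrow> (nat \<Rightarrow> nat) set" where
  "symmetry_group n w =
     {\<pi>. \<pi> permutes {1..n} \<and> (\<forall>x \<in> factors_of_length n w. perm_act \<pi> x \<in> factors_of_length n w)}"

definition universal :: "'a set \<Rightarrow> 'a word \<Rightarrow> bool" where
  "universal A w \<longleftrightarrow> factors w = lists A"

definition periodic_by_projection :: "'a set \<Rightarrow> nat \<Rightarrow> 'a word \<Rightarrow> bool" where
  "periodic_by_projection \<Sigma> T w \<longleftrightarrow> (\<forall>i<T. \<exists>A. A \<subseteq> \<Sigma> \<and> universal A (\<lambda>k. w (i + k * T)))"

text \<open>
  The start positions \<open>s 1, \<dots>, s T\<close> range over all choices with \<open>s j\<close> in the residue class
  of \<open>j\<close>; in particular \<open>s T\<close> lies in the class of \<open>0\<close>.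
\<close>

definition mixing :: "nat \<Rightarrow> 'a word \<Rightarrow> bool" where
  "mixing T w \<longleftrightarrow>
     (\<forall>n. \<forall>s :: nat \<Rightarrow> nat. (\<forall>j \<in> {1..T}. [s j = j] (mod T)) \<longrightarrow>
        concat (map (\<lambda>k. map (\<lambda>j. w (s j + k * T)) [1..<T + 1]) [0..<n]) \<in> factors w)"

end

theory Submission
  imports Defs
begin

text \<open>
  Both sides are equivalent to the following: every sequence \<open>f\<close> that takes, at each position
  \<open>t\<close>, a letter that \<open>w\<close> has somewhere in the residue class of \<open>t\<close> modulo \<open>T\<close>, has all its
  prefixes among the factors of \<open>w\<close>. The delicate point is that a permuted factor may reappear
  in \<open>w\<close> with a different phase modulo \<open>T\<close>. If it is long enough to show all letters of all
  classes, reappearing at \<open>q\<close> gives an inclusion of the letters of class \<open>j\<close> in those of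
  class \<open>j + q\<close> for every \<open>j\<close>; as translation by \<open>q\<close> has finite order modulo \<open>T\<close>, such a
  phase shift is harmless.
\<close>

section \<open>Letters of the residue classes, factors and universality\<close>

text \<open>The class index is any natural number, not only a residue below \<open>T\<close>, so
  positions and shifted classes such as \<open>i + n * q\<close> serve as indices without
  reduction.\<close>

definition class_letters :: "nat \<Rightarrow> 'a word \<Rightarrow> nat \<Rightarrow> 'a set" where
  "class_letters T w c = {w p | p. p mod T = c mod T}"

text \<open>\<open>f\<close> is infinite so that the condition on classes needs no bound; the
  residue of \<open>q\<close> modulo \<open>T\<close> is left open.\<close>

definition realizes_classes :: "nat \<Rightarrow> 'a word \<Rightarrow> bool" where
  "realizes_classes T w \<longleftrightarrow>
     (\<forall>f m. (\<forall>t. f t \<in> class_letters T w t) \<longrightarrow> (\<exists>q. \<forall>t<m. w (q + t) = f t))"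

lemma class_letters_self [simp]: "w t \<in> class_letters T w t"
  by (auto simp: class_letters_def)

lemma class_letters_cong:
  "c mod T = d mod T \<Longrightarrow> class_letters T w c = class_letters T w d"
  by (simp add: class_letters_def)

lemma class_letters_eq_range:
  assumes "i < T"
  shows "class_letters T w i = range (\<lambda>k. w (i + k * T))"
proof (intro equalityI subsetI)
  fix b assume "b \<in> class_letters T w i"
  then obtain p where p: "b = w p" "p mod T = i" using assms by (auto simp: class_letters_def)
  then have "p = i + (p div T) * T" using mod_div_mult_eq[of p T] by simp
  with p(1) show "b \<in> range (\<lambda>k. w (i + k * T))" by (metis rangeI)
qed (auto simp: class_letters_def)

lemma mem_factors_iff:
  "u \<in> factors w \<longleftrightarrow> (\<exists>q. \<forall>t<length u. u ! t = w (q + t))"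
proof
  assume "u \<in> factors w"
  then obtain i j where "i \<le> j" "u = w [i \<rightarrow> j]" by (auto simp: factors_def)
  then have "\<forall>t<length u. u ! t = w (i + t)" by (auto simp: subsequence_def)
  then show "\<exists>q. \<forall>t<length u. u ! t = w (q + t)" ..
next
  assume "\<exists>q. \<forall>t<length u. u ! t = w (q + t)"
  then obtain q where "\<forall>t<length u. u ! t = w (q + t)" ..
  then have "u = w [q \<rightarrow> q + length u]" by (intro nth_equalityI) (auto simp: subsequence_def)
  then show "u \<in> factors w" unfolding factors_def using le_add1 by blast
qed

text \<open>Comparing one-letter words identifies \<open>A\<close> with \<open>range w\<close>, so
  the alphabets in \<open>periodic_by_projection\<close> are determined by the word.\<close>

lemma universal_iff_range: "universal A w \<longleftrightarrow> A = range w \<and> lists (range w) \<subseteq> factors w"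
proof -
  have 1: "factors w \<subseteq> lists (range w)"
  proof
    fix u assume "u \<in> factors w"
    then show "u \<in> lists (range w)" by (auto simp: mem_factors_iff in_lists_conv_set in_set_conv_nth)
  qed
  have "A = range w" if "factors w = lists A"
  proof (intro equalityI subsetI)
    fix b assume "b \<in> A"
    then have "[b] \<in> factors w" using that by simp
    with 1 show "b \<in> range w" by auto
  next
    fix b assume "b \<in> range w"
    then obtain k where "b = w k" by auto
    then have "[b] \<in> factors w" by (auto simp: mem_factors_iff intro!: exI[of _ k])
    then show "b \<in> A" using that by auto
  qed
  with 1 show ?thesis unfolding universal_def by blast
qed

lemma periodic_by_projection_iff:
  assumes "range w \<subseteq> \<Sigma>"
  shows "periodic_by_projection \<Sigma> T w \<longleftrightarrow>
    (\<forall>i<T. lists (class_letters T w i) \<subseteq> factors (\<lambda>k. w (i + k * T)))"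
proof -
  have "range (\<lambda>k. w (i + k * T)) \<subseteq> \<Sigma>" for i using assms by auto
  then show ?thesis
    by (auto simp: periodic_by_projection_def universal_iff_range class_letters_eq_range)
qed

text \<open>Position \<open>t\<close> of the concatenation lies in block \<open>t div T\<close> at
  offset \<open>t mod T\<close>; the \<open>+ 1\<close> appears because \<open>j\<close> counts from
  1.\<close>

lemma concat_blocks:
  "concat (map (\<lambda>k. map (\<lambda>j. h j k) [1..<T + 1]) [0..<n])
    = map (\<lambda>t. h (t mod T + 1) (t div T)) [0..<n * T]"
proof (cases "T = 0")
  case False
  show ?thesis
  proof (induction n)
    case (Suc n)
    have "[0..<Suc n * T] = [0..<n * T] @ map (\<lambda>j. j + n * T) [0..<T]"
      by (metis add.commute add_0 map_add_upt mult_Suc upt_add_eq_append zero_le)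
    moreover have "map (\<lambda>j. h j n) [1..<T + 1]
        = map (\<lambda>t. h (t mod T + 1) (t div T)) (map (\<lambda>j. j + n * T) [0..<T])"
      using False by (intro nth_equalityI) (auto simp del: upt_Suc)
    ultimately show ?case using Suc by (simp del: upt_Suc mult_Suc) (simp add: upt_Suc)
  qed simp
qed simp

lemma length_perm_act [simp]: "length (perm_act g u) = length u"
  by (simp add: perm_act_def del: upt_Suc)

lemma nth_perm_act: "t < length u \<Longrightarrow> perm_act g u ! t = u ! (inv g (Suc t) - 1)"
  by (simp add: perm_act_def del: upt_Suc)

section \<open>Mixing in terms of realized class sequences\<close>

lemma realizes_classes_imp_mixing:
  assumes "realizes_classes T w"
  shows "mixing T w"
  unfolding mixing_def
proof (intro allI impI)
  fix n and s :: "nat \<Rightarrow> nat"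
  assume s: "\<forall>j\<in>{1..T}. [s j = j] (mod T)"
  show "concat (map (\<lambda>k. map (\<lambda>j. w (s j + k * T)) [1..<T + 1]) [0..<n]) \<in> factors w"
  proof (cases "T = 0")
    case True
    then show ?thesis
      unfolding concat_blocks[of "\<lambda>j k. w (s j + k * T)"] by (auto simp: mem_factors_iff)
  next
    case False
    define h where "h t = w (s (t mod T + 1) + t div T * T)" for t
    \<comment> \<open>Mixed words start in class 1, sequences in \<open>realizes_classes\<close> in
      class 0. A letter of class 0 is put in front and later skipped by
      \<open>Suc q\<close>.\<close>
    define f where "f t = (if t = 0 then w 0 else h (t - 1))" for t
    have "f t \<in> class_letters T w t" for t
    proof (cases t)
      case (Suc t')
      have "t' mod T + 1 \<in> {1..T}" using False by (auto simp: Suc_le_eq)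
      then have "s (t' mod T + 1) mod T = (t' mod T + 1) mod T" using s by (auto simp: cong_def)
      then have "(s (t' mod T + 1) + t' div T * T) mod T = t mod T"
        using Suc by (simp add: mod_Suc_eq)
      then show ?thesis using Suc by (auto simp: f_def h_def class_letters_def)
    qed (simp add: f_def)
    then obtain q where q: "\<forall>t<Suc (n * T). w (q + t) = f t"
      using assms unfolding realizes_classes_def by blast
    have "h t = w (Suc q + t)" if "t < n * T" for t
      using q[rule_format, of "Suc t"] that by (simp add: f_def)
    then show ?thesis
      unfolding concat_blocks[of "\<lambda>j k. w (s j + k * T)"]
      by (auto simp: mem_factors_iff h_def intro!: exI[of _ "Suc q"])
  qed
qed

text \<open>Universality finds, in the projection to each class, a stretch that spells the letters
  \<open>f\<close> prescribes there; mixing interleaves these stretches.\<close>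

lemma mixing_imp_realizes_classes:
  assumes T: "T \<ge> 1" and mix: "mixing T w"
    and proj: "\<And>i. i < T \<Longrightarrow> lists (class_letters T w i) \<subseteq> factors (\<lambda>k. w (i + k * T))"
  shows "realizes_classes T w"
proof -
  have shifted: "\<exists>q. \<forall>t<m. w (q + t) = f (Suc t)" if f: "\<And>t. f t \<in> class_letters T w t" for f m
  proof -
    have "\<exists>s. [s = j] (mod T) \<and> (\<forall>k<m. w (s + k * T) = f (j + k * T))" for j
    proof -
      let ?u = "map (\<lambda>k. f (j + k * T)) [0..<m]"
      have "f (j + k * T) \<in> class_letters T w (j mod T)" for k
        using f[of "j + k * T"] class_letters_cong[of "j + k * T" T "j mod T" w] by simp
      then have "?u \<in> lists (class_letters T w (j mod T))" by auto
      then have "?u \<in> factors (\<lambda>k. w (j mod T + k * T))" using proj[of "j mod T"] T by auto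
      then obtain a where "\<forall>k<m. f (j + k * T) = w (j mod T + (a + k) * T)"
        by (auto simp: mem_factors_iff)
      then show ?thesis
        by (intro exI[of _ "j mod T + a * T"]) (auto simp: cong_def algebra_simps)
    qed
    then obtain s where s: "\<And>j. [s j = j] (mod T)"
      and ws: "\<And>j k. k < m \<Longrightarrow> w (s j + k * T) = f (j + k * T)" by metis
    from mix s have "concat (map (\<lambda>k. map (\<lambda>j. w (s j + k * T)) [1..<T + 1]) [0..<m]) \<in> factors w"
      unfolding mixing_def by blast
    then obtain q where
      q: "\<forall>t<m * T. w (s (t mod T + 1) + t div T * T) = w (q + t)"
      unfolding concat_blocks[of "\<lambda>j k. w (s j + k * T)"] by (auto simp: mem_factors_iff)
    have "w (q + t) = f (Suc t)" if "t < m" for t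
    proof -
      \<comment> \<open>\<open>m\<close> blocks contain at least \<open>m\<close> letters, and
        \<open>t mod T + 1 + t div T * T\<close> is just \<open>Suc t\<close>.\<close>
      have "m * 1 \<le> m * T" using T mult_le_mono2 by blast
      then have "t < m * T" using that by linarith
      moreover have "t div T < m" using that div_le_dividend le_less_trans by blast
      ultimately have "w (q + t) = f (t mod T + 1 + t div T * T)" using q ws by metis
      then show ?thesis by simp
    qed
    then show ?thesis by blast
  qed
  show ?thesis unfolding realizes_classes_def
  proof (intro allI impI)
    fix f :: "nat \<Rightarrow> 'a" and m :: nat
    assume f: "\<forall>t. f t \<in> class_letters T w t"
    \<comment> \<open>Since \<open>shifted\<close> loses the letter at 0, a whole period is put in
      front of \<open>f\<close>, which keeps the classes; skipping the \<open>T - 1\<close> letters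
      that remain of it gives \<open>f\<close>.\<close>
    define f' where "f' t = (if t < T then w t else f (t - T))" for t
    have "f' t \<in> class_letters T w t" for t
    proof (cases "t < T")
      case False
      then have "class_letters T w (t - T) = class_letters T w t"
        by (intro class_letters_cong) (simp add: le_mod_geq)
      then show ?thesis using f False by (metis f'_def)
    qed (simp add: f'_def)
    then obtain q where q: "\<forall>t<T - 1 + m. w (q + t) = f' (Suc t)" using shifted by blast
    have "w (q + (T - 1) + t) = f t" if "t < m" for t
      using q[rule_format, of "T - 1 + t"] that T by (simp add: f'_def add.assoc)
    then show "\<exists>q. \<forall>t<m. w (q + t) = f t" by blast
  qed
qed

section \<open>From realized class sequences to permutations\<close>

text \<open>\<open>\<pi>\<close> moves only indices congruent to \<open>i\<close> modulo
  \<open>T\<close>, so it preserves residues, and the permuted factor still takes its letters from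
  the right classes.\<close>

lemma realizes_classes_imp_symmetric:
  assumes real: "realizes_classes T w" and "i \<ge> 1" and "i + k * T \<le> n"
    and pi: "\<pi> permutes {i + j * T | j. j \<le> k}"
  shows "\<pi> \<in> symmetry_group n w"
proof -
  let ?S = "{i + j * T | j. j \<le> k}"
  have sub: "?S \<subseteq> {1..n}"
  proof
    fix a assume "a \<in> ?S"
    then obtain j where j: "a = i + j * T" "j \<le> k" by auto
    then have "j * T \<le> k * T" by (intro mult_le_mono1)
    then have "i + j * T \<le> n" using assms(3) by linarith
    then show "a \<in> {1..n}" using assms(2) j(1) by simp
  qed
  have inv_mem: "inv \<pi> a \<in> {1..n}" if "a \<in> {1..n}" for a
    using permutes_in_image[OF permutes_inv[OF permutes_subset[OF pi sub]]] that by blast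
  have inv_mod: "inv \<pi> a mod T = a mod T" for a
  proof (cases "a \<in> ?S")
    case True
    then have "inv \<pi> a \<in> ?S" using permutes_in_image[OF permutes_inv[OF pi]] by blast
    then show ?thesis using True by auto
  next
    case False
    then show ?thesis using permutes_not_in[OF permutes_inv[OF pi] False] by simp
  qed
  have "perm_act \<pi> x \<in> factors w" if x: "x \<in> factors w" "length x = n" for x
  proof -
    obtain p where p: "\<forall>t<n. x ! t = w (p + t)" using x by (auto simp: mem_factors_iff)
    \<comment> \<open>Putting the permuted factor into \<open>w\<close> at the occurrence
      \<open>p\<close> of \<open>x\<close> keeps the classes aligned, whatever
      \<open>p mod T\<close> is.\<close>
    define f where "f t = (if p \<le> t \<and> t < p + n then perm_act \<pi> x ! (t - p) else w t)" for t
    have "f t \<in> class_letters T w t" for t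
    proof (cases "p \<le> t \<and> t < p + n")
      case True
      define b where "b = inv \<pi> (Suc (t - p))"
      have "b \<in> {1..n}" using True inv_mem unfolding b_def by auto
      then have b: "1 \<le> b" "b - 1 < n" by auto
      have "f t = x ! (b - 1)"
        using True x(2) nth_perm_act[of "t - p" x \<pi>] by (auto simp: f_def b_def)
      also have "\<dots> = w (p + (b - 1))" using p b(2) by blast
      finally have "f t = w (p + (b - 1))" .
      moreover have "(p + (b - 1)) mod T = t mod T"
      proof -
        \<comment> \<open>Permutations count positions from 1, lists from 0; the offset occurs on
          both sides and cancels.\<close>
        have "[b - 1 + 1 = t - p + 1] (mod T)"
          using inv_mod[of "Suc (t - p)"] b(1) by (simp add: cong_def flip: b_def)
        then have "[b - 1 = t - p] (mod T)" by (simp only: cong_add_rcancel_nat)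
        then have "[p + (b - 1) = p + (t - p)] (mod T)" by (intro cong_add cong_refl)
        then show ?thesis using True by (simp add: cong_def)
      qed
      ultimately show ?thesis by (auto simp: class_letters_def)
    qed (auto simp: f_def)
    then obtain q where "\<forall>t<p + n. w (q + t) = f t"
      using real unfolding realizes_classes_def by blast
    then have "\<forall>t<n. perm_act \<pi> x ! t = w (q + p + t)" by (simp add: f_def add.assoc)
    then show ?thesis using x by (auto simp: mem_factors_iff)
  qed
  then show ?thesis
    using permutes_subset[OF pi sub] by (auto simp: symmetry_group_def factors_of_length_def)
qed

section \<open>From permutations to realized class sequences\<close>

locale class_symmetric =
  fixes w :: "'a word" and T :: nat
  assumes finite_range: "finite (range w)" and T_pos: "T \<ge> 1"
    and class_permutation: "\<And>i n k \<pi>. i \<in> {1..T} \<Longrightarrow> i + k * T \<le> n \<Longrightarrow>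
      \<pi> permutes {i + j * T | j. j \<le> k} \<Longrightarrow> \<pi> \<in> symmetry_group n w"
begin

lemma swap_factor:
  assumes x: "x \<in> factors w" and p: "p < length x" and q: "q < length x"
    and pq: "p mod T = q mod T"
  shows "\<exists>y \<in> factors w. length y = length x \<and>
    (\<forall>t<length x. y ! t = x ! (transpose p q t))"
proof -
  let ?g = "transpose (Suc p) (Suc q)"
  \<comment> \<open>Counted from 1, both positions lie in the progression that starts at
    \<open>i\<close>; \<open>k\<close> reaches the farther of the two.\<close>
  define i where "i = Suc (p mod T)"
  define k where "k = max (p div T) (q div T)"
  have Sp: "Suc p = i + p div T * T" by (simp add: i_def)
  have Sq: "Suc q = i + q div T * T" unfolding i_def pq by simp
  have "i + k * T \<le> length x" using p q Sp Sq by (auto simp: k_def max_def)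
  moreover have "i \<in> {1..T}" using T_pos by (auto simp: i_def Suc_le_eq)
  moreover have "?g permutes {i + j * T | j. j \<le> k}"
    by (rule permutes_swap_id) (use Sp Sq in \<open>auto simp: k_def\<close>)
  ultimately have "?g \<in> symmetry_group (length x) w" by (intro class_permutation)
  then have "perm_act ?g x \<in> factors w"
    using x by (auto simp: symmetry_group_def factors_of_length_def)
  moreover have "perm_act ?g x ! t = x ! (transpose p q t)" if "t < length x" for t
    using that by (simp add: nth_perm_act transpose_def)
  ultimately show ?thesis by (intro bexI[of _ "perm_act ?g x"]) auto
qed

text \<open>The letters are moved by one swap each. Disjointness of sources and targets ensures that
  no swap disturbs a pending source or a filled target; the clause on untouched positions carries
  this through the induction.\<close>

lemma move_letters:
  assumes x: "x \<in> factors w" and "finite I"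
    and "inj_on src I" and "inj_on tgt I" and "src ` I \<inter> tgt ` I = {}"
    and "\<And>a. a \<in> I \<Longrightarrow> src a < length x \<and> tgt a < length x \<and> src a mod T = tgt a mod T"
  shows "\<exists>y \<in> factors w. length y = length x \<and> (\<forall>a\<in>I. y ! tgt a = x ! src a) \<and>
    (\<forall>t<length x. t \<notin> src ` I \<longrightarrow> t \<notin> tgt ` I \<longrightarrow> y ! t = x ! t)"
  using assms(2-)
proof (induction I rule: finite_induct)
  case empty
  then show ?case using x by auto
next
  case (insert a I)
  have "\<exists>y \<in> factors w. length y = length x \<and> (\<forall>a\<in>I. y ! tgt a = x ! src a) \<and>
    (\<forall>t<length x. t \<notin> src ` I \<longrightarrow> t \<notin> tgt ` I \<longrightarrow> y ! t = x ! t)"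
    using insert.prems by (intro insert.IH) auto
  then obtain y where y: "y \<in> factors w" "length y = length x"
    "\<And>b. b \<in> I \<Longrightarrow> y ! tgt b = x ! src b"
    "\<And>t. t < length x \<Longrightarrow> t \<notin> src ` I \<Longrightarrow> t \<notin> tgt ` I \<Longrightarrow> y ! t = x ! t" by blast
  have a: "src a < length x" "tgt a < length x" "src a mod T = tgt a mod T"
    using insert.prems(4)[of a] by auto
  then obtain z where z: "z \<in> factors w" "length z = length x"
    "\<And>t. t < length x \<Longrightarrow> z ! t = y ! (transpose (src a) (tgt a) t)"
    using swap_factor[OF y(1), of "src a" "tgt a"] y(2) by auto
  have neq: "src a \<notin> src ` I" "src a \<notin> tgt ` I" "tgt a \<notin> tgt ` I"
    using insert.prems(1-3) insert.hyps(2) by auto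
  have "z ! tgt a = x ! src a" using z(3)[OF a(2)] y(4)[OF a(1)] neq by simp
  moreover have "z ! tgt b = x ! src b" if "b \<in> I" for b
  proof -
    have "tgt b \<in> tgt ` I" using that by (rule imageI)
    with neq have "tgt b \<noteq> src a" "tgt b \<noteq> tgt a" by metis+
    moreover have "tgt b < length x" using insert.prems(4) that by blast
    ultimately show ?thesis using z(3) y(3) that by simp
  qed
  moreover have "z ! t = x ! t"
    if "t < length x" "t \<notin> src ` insert a I" "t \<notin> tgt ` insert a I" for t
    using that z(3) y(4) by simp
  ultimately show ?case using z(1,2) by blast
qed

lemma prefix_mem_factors: "map w [0..<n] \<in> factors w"
  by (auto simp: mem_factors_iff intro!: exI[of _ 0])

lemma prefix_recurs: "\<exists>q\<ge>N. \<forall>t<K. w (q + t) = w t"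
proof -
  \<comment> \<open>A multiple of \<open>T\<close>, so that moving by \<open>d\<close> stays in the
    class; at least \<open>K\<close>, so that source and target blocks are disjoint; at least
    \<open>N\<close>, so that the copy lies far enough out.\<close>
  define d where "d = (N + K) * T"
  have d: "N + K \<le> d" "\<And>a. (d + a) mod T = a mod T" using T_pos by (simp_all add: d_def)
  have "\<exists>y \<in> factors w. length y = length (map w [0..<d + K]) \<and>
      (\<forall>a\<in>{..<K}. y ! (d + a) = map w [0..<d + K] ! a) \<and>
      (\<forall>t<length (map w [0..<d + K]). t \<notin> (\<lambda>a. a) ` {..<K} \<longrightarrow>
        t \<notin> (\<lambda>a. d + a) ` {..<K} \<longrightarrow> y ! t = map w [0..<d + K] ! t)"
    by (intro move_letters prefix_mem_factors) (use d in \<open>auto simp: inj_on_def\<close>)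
  then obtain y where y: "y \<in> factors w" "length y = d + K" "\<And>a. a < K \<Longrightarrow> y ! (d + a) = w a"
    by auto
  then obtain q where "\<And>t. t < d + K \<Longrightarrow> y ! t = w (q + t)" by (auto simp: mem_factors_iff)
  then have "w (q + d + t) = w t" if "t < K" for t
    using y(3)[OF that] that by (simp add: add.assoc)
  moreover have "q + d \<ge> N" using d by simp
  ultimately show ?thesis by blast
qed

text \<open>Only finitely many pairs of a residue and a letter occur in \<open>w\<close>;
  \<open>K\<close> exceeds one chosen position for each pair.\<close>

lemma exhausting_prefix:
  obtains K where "\<And>c b. b \<in> class_letters T w c \<Longrightarrow> \<exists>s<K. s mod T = c mod T \<and> w s = b"
proof -
  let ?f = "\<lambda>t. (t mod T, w t)"
  have "range ?f \<subseteq> {..<T} \<times> range w" using T_pos by auto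
  then have "finite (range ?f)" using finite_range finite_subset by blast
  then obtain C where C: "finite C" "range ?f = ?f ` C"
    using finite_subset_image[of "range ?f" ?f UNIV] by blast
  obtain K where K: "\<forall>t\<in>C. t < K" using C(1) finite_nat_set_iff_bounded by blast
  have "\<exists>s<K. s mod T = c mod T \<and> w s = b" if b: "b \<in> class_letters T w c" for c b
  proof -
    from b obtain p where "w p = b" "p mod T = c mod T" by (auto simp: class_letters_def)
    moreover have "?f p \<in> ?f ` C" using C(2) by blast
    ultimately show ?thesis using K by auto
  qed
  then show thesis by (rule that)
qed

text \<open>The prefix of length \<open>K\<close> shows every letter of every class, and its
  recurrence at \<open>q\<close> shows it again \<open>q\<close> classes further; this is iterated
  \<open>n\<close> times.\<close>

lemma class_letters_shift:
  assumes K: "\<And>c b. b \<in> class_letters T w c \<Longrightarrow> \<exists>s<K. s mod T = c mod T \<and> w s = b"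
    and q: "\<forall>t<K. w (q + t) = w t"
  shows "class_letters T w i \<subseteq> class_letters T w (i + n * q)"
proof (induction n)
  case (Suc n)
  show ?case
  proof
    fix b assume "b \<in> class_letters T w i"
    then have "b \<in> class_letters T w (i + n * q)" using Suc by blast
    then obtain s where s: "s < K" "s mod T = (i + n * q) mod T" "w s = b" using K by blast
    then have "(q + s) mod T = (i + Suc n * q) mod T"
      by (metis add.left_commute mod_add_right_eq mult_Suc)
    moreover have "w (q + s) = b" using q s by simp
    ultimately show "b \<in> class_letters T w (i + Suc n * q)" by (auto simp: class_letters_def)
  qed
qed simp

text \<open>The shifts add up to \<open>T * q\<close>, so \<open>T - 1\<close> shifts by
  \<open>q\<close> act as the inverse of one.\<close>

lemma shift_back_mod: "(q + (i + (T - 1) * q)) mod T = i mod T"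
proof -
  have "q + (i + (T - 1) * q) = i + T * q" using T_pos by (cases T) simp_all
  then show ?thesis by (simp only: mod_mult_self2)
qed

text \<open>A late recurrence of the prefix may change the phase by \<open>q\<close>. Hence
  \<open>b\<close> is looked up in the class that this shift carries to class \<open>i\<close>;
  \<open>class_letters_shift\<close> shows that \<open>b\<close> occurs there.\<close>

lemma letter_recurs:
  assumes b: "b \<in> class_letters T w i"
  shows "\<exists>p\<ge>N. p mod T = i mod T \<and> w p = b"
proof -
  obtain K where K: "\<And>c b. b \<in> class_letters T w c \<Longrightarrow> \<exists>s<K. s mod T = c mod T \<and> w s = b"
    using exhausting_prefix by blast
  obtain q where q: "q \<ge> N" "\<forall>t<K. w (q + t) = w t" using prefix_recurs by blast
  have "b \<in> class_letters T w (i + (T - 1) * q)" using class_letters_shift[OF K q(2)] b by blast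
  then obtain s where s: "s < K" "s mod T = (i + (T - 1) * q) mod T" "w s = b" using K by blast
  then have "(q + s) mod T = i mod T" by (metis mod_add_right_eq shift_back_mod)
  moreover have "w (q + s) = b" using q s by simp
  ultimately show ?thesis using q(1) by (intro exI[of _ "q + s"]) simp
qed

text \<open>Letters \<open>f t\<close> are fetched from late positions \<open>\<sigma> t\<close> of
  class \<open>t\<close> and moved to the front of a prefix of \<open>w\<close>.\<close>

lemma realizes_classes: "realizes_classes T w"
  unfolding realizes_classes_def
proof (intro allI impI)
  fix f :: "nat \<Rightarrow> 'a" and m :: nat
  assume f: "\<forall>t. f t \<in> class_letters T w t"
  \<comment> \<open>The bound \<open>p \<ge> m\<close> separates the sources from the targets below
    \<open>m\<close>; the increasing choice of \<open>\<sigma>\<close> makes the sources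
    distinct.\<close>
  define P where "P t p \<longleftrightarrow> p \<ge> m \<and> p mod T = t mod T \<and> w p = f t" for t p
  have ex: "\<exists>p\<ge>N. P t p" for N t
    using letter_recurs[of "f t" t "max N m"] f by (auto simp: P_def)
  have "\<exists>\<sigma>. \<forall>t. P t (\<sigma> t) \<and> \<sigma> t < \<sigma> (Suc t)"
    by (rule dependent_nat_choice) (use ex in \<open>auto simp: Suc_le_eq[symmetric]\<close>)
  then obtain \<sigma> where \<sigma>: "\<And>t. P t (\<sigma> t)" "\<And>t. \<sigma> t < \<sigma> (Suc t)" by blast
  have mono: "strict_mono \<sigma>" using \<sigma>(2) by (simp add: strict_mono_Suc_iff)
  \<comment> \<open>Ending at \<open>\<sigma> m\<close>, the prefix contains all sources by
    monotonicity and all targets because \<open>m \<le> \<sigma> m\<close>.\<close>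
  let ?x = "map w [0..<\<sigma> m + 1]"
  have "\<sigma> t < \<sigma> m + 1" if "t < m" for t
    using strict_monoD[OF mono that] by simp
  moreover have "m \<le> \<sigma> t" "\<sigma> t mod T = t mod T" "w (\<sigma> t) = f t" for t
    using \<sigma>(1)[of t] by (auto simp: P_def)
  moreover have "t < \<sigma> m + 1" if "t < m" for t using calculation(2)[of m] that by simp
  ultimately have "\<exists>y \<in> factors w. length y = length ?x \<and>
      (\<forall>a\<in>{..<m}. y ! a = ?x ! \<sigma> a) \<and>
      (\<forall>t<length ?x. t \<notin> \<sigma> ` {..<m} \<longrightarrow> t \<notin> (\<lambda>a. a) ` {..<m} \<longrightarrow> y ! t = ?x ! t)"
    by (intro move_letters prefix_mem_factors)
      (auto simp: leD intro: inj_on_subset[OF strict_mono_imp_inj_on[OF mono]] simp del: upt_Suc)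
  then obtain y where y: "y \<in> factors w" "length y = \<sigma> m + 1" "\<And>t. t < m \<Longrightarrow> y ! t = ?x ! \<sigma> t"
    by auto
  then obtain q where q: "\<And>t. t < \<sigma> m + 1 \<Longrightarrow> y ! t = w (q + t)" by (auto simp: mem_factors_iff)
  have "w (q + t) = f t" if "t < m" for t
  proof -
    have "\<sigma> t < \<sigma> m + 1" "t < \<sigma> m + 1"
      using strict_monoD[OF mono that] \<sigma>(1)[of m] that by (auto simp: P_def)
    then have "?x ! \<sigma> t = w (\<sigma> t)" by (simp del: upt_Suc)
    then show ?thesis using y(3)[OF that] q \<open>t < \<sigma> m + 1\<close> \<sigma>(1)[of t] by (simp add: P_def)
  qed
  then show "\<exists>q. \<forall>t<m. w (q + t) = f t" by blast
qed

text \<open>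
  As the phase of the occurrence is not known beforehand, the word is planted in every residue
  class whose letters allow it.
\<close>

lemma projection_universal:
  assumes i: "i < T"
  shows "lists (class_letters T w i) \<subseteq> factors (\<lambda>k. w (i + k * T))"
proof
  fix u assume u: "u \<in> lists (class_letters T w i)"
  obtain K where K: "\<And>c b. b \<in> class_letters T w c \<Longrightarrow> \<exists>s<K. s mod T = c mod T \<and> w s = b"
    using exhausting_prefix by blast
  \<comment> \<open>A multiple of \<open>T\<close>, to keep classes, and at least \<open>K\<close>,
    so that \<open>f\<close> begins with the exhausting prefix and
    \<open>class_letters_shift\<close> applies to its occurrence.\<close>
  define L where "L = K * T"
  have KL: "K \<le> L" using T_pos by (simp add: L_def)
  \<comment> \<open>Block \<open>k\<close> of length \<open>T\<close> after \<open>L\<close> carries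
    the letter \<open>u ! k\<close> in every admissible class, so \<open>u\<close> is read along
    each such class.\<close>
  define f where "f t = (if L \<le> t \<and> (t - L) div T < length u \<and> u \<in> lists (class_letters T w t)
     then u ! ((t - L) div T) else w t)" for t
  have "\<forall>t. f t \<in> class_letters T w t"
    by (auto simp: f_def in_lists_conv_set)
  then obtain q where q: "\<And>t. t < L + length u * T \<Longrightarrow> w (q + t) = f t"
    using realizes_classes unfolding realizes_classes_def by blast
  then have prefix: "\<forall>t<K. w (q + t) = w t" using KL by (simp add: f_def)
  have sub: "class_letters T w i \<subseteq> class_letters T w (i + (T - 1) * q)"
    using class_letters_shift[OF K prefix] by blast
  \<comment> \<open>The shift by \<open>q\<close> carries this class to class \<open>i\<close>; by
    \<open>sub\<close>, \<open>u\<close> was planted in it.\<close>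
  define j where "j = (i + (T - 1) * q) mod T"
  have j: "j < T" using T_pos by (simp add: j_def)
  have uj: "u \<in> lists (class_letters T w (L + (j + k * T)))" for k
  proof -
    have "class_letters T w (L + (j + k * T)) = class_letters T w (i + (T - 1) * q)"
      by (rule class_letters_cong) (simp add: L_def j_def)
    then show ?thesis using u sub by (auto simp: in_lists_conv_set)
  qed
  have "q + L + j = q + j + K * T" by (simp add: L_def)
  then have "(q + L + j) mod T = (q + j) mod T" by (simp only: mod_mult_self1)
  also have "\<dots> = (q + (i + (T - 1) * q)) mod T" unfolding j_def by (rule mod_add_right_eq)
  also have "\<dots> = i" using i by (simp only: shift_back_mod mod_less)
  finally have phase: "(q + L + j) mod T = i" .
  have a: "q + L + j = i + (q + L + j) div T * T" (is "_ = i + ?a * T")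
    using mod_div_mult_eq[of "q + L + j" T] unfolding phase by (rule sym)
  have "u ! k = w (i + (?a + k) * T)" if k: "k < length u" for k
  proof -
    have "Suc k * T \<le> length u * T" using k by (intro mult_le_mono1) simp
    then have "L + (j + k * T) < L + length u * T" using j by simp
    then have "w (q + (L + (j + k * T))) = f (L + (j + k * T))" by (rule q)
    also have "\<dots> = u ! k" using uj[of k] j k by (simp add: f_def)
    finally have "w (q + (L + (j + k * T))) = u ! k" .
    moreover have "q + (L + (j + k * T)) = i + (?a + k) * T"
      using a unfolding add_mult_distrib by linarith
    ultimately show ?thesis by simp
  qed
  then show "u \<in> factors (\<lambda>k. w (i + k * T))" by (auto simp: mem_factors_iff)
qed

end

section \<open>The equivalence, by way of \<open>realizes_classes\<close>\<close>

theorem proposition7: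
  fixes \<Sigma> :: "'a set" and w :: "'a word" and T :: nat
  assumes "finite \<Sigma>" and "range w \<subseteq> \<Sigma>" and "T \<ge> 1"
  shows "periodic_by_projection \<Sigma> T w \<and> mixing T w \<longleftrightarrow>
    (\<forall>i \<in> {1..T}. \<forall>n k. i + k * T \<le> n \<longrightarrow>
       (\<forall>\<pi>. \<pi> permutes {i + j * T | j. j \<le> k} \<longrightarrow> \<pi> \<in> symmetry_group n w))"
    (is "?L \<longleftrightarrow> ?R")
proof
  assume ?L
  then have "realizes_classes T w"
    using mixing_imp_realizes_classes[OF assms(3)] periodic_by_projection_iff[OF assms(2)] by blast
  then show ?R by (auto intro: realizes_classes_imp_symmetric)
next
  assume R: ?R
  interpret class_symmetric w T
  proof
    show "finite (range w)" using assms(2,1) by (rule finite_subset)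
    show "T \<ge> 1" by (rule assms(3))
    show "\<pi> \<in> symmetry_group n w"
      if "i \<in> {1..T}" "i + k * T \<le> n" "\<pi> permutes {i + j * T | j. j \<le> k}" for i n k \<pi>
      using R[rule_format, OF that] .
  qed
  show ?L
    using projection_universal realizes_classes_imp_mixing[OF realizes_classes]
      periodic_by_projection_iff[OF assms(2)] by blast
qed

end
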